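(* Let $A=\{\mathbf a_1,\ldots,\mathbf a_m\}\subset\mathbb Z^n$ be a vector configuration such that $\mathbb NA$ is pointed, and let $I_A\subset K[x_1,\ldots,x_m]$ be its toric ideal. A binomial $B=\mathbf x^{\mathbf u}-\mathbf x^{\mathbf v}\in I_A$ is indispensable if and only if $\{\mathbf x^{\mathbf u},\mathbf x^{\mathbf v}\}$ is a $1$-dimensional facet of the indispensable complex $\Delta_{\mathrm{ind}(A)}$ and $\deg_A(B)$ is a minimal binomial $A$-degree.
   Context: $K$ is a field. $\mathbb NA=\{l_1\mathbf a_1+\cdots+l_m\mathbf a_m : l_i\in\mathbb N\}$ with $0\in\mathbb N$; $\mathbb NA$ is pointed if zero is its only invertible element. The $A$-degree of $\mathbf x^{\mathbf u}=x_1^{u_1}\cdots x_m^{u_m}$ is $\deg_A(\mathbf x^{\mathbf u})=u_1\mathbf a_1+\cdots+u_m\mathbf a_m$. The toric ideal $I_A$ is the ideal generated by all binomials $\mathbf x^{\mathbf u}-\mathbf x^{\mathbf v}$ with $\deg_A(\mathbf x^{\mathbf u})=\deg_A(\mathbf x^{\mathbf v})$; for such a binomial, $\deg_A(\mathbf x^{\mathbf u}-\mathbf x^{\mathbf v}):=\deg_A(\mathbf x^{\mathbf u})$. Partial order on $\mathbb NA$: $\mathbf c\ge\mathbf d$ iff $\mathbf c=\mathbf d+\mathbf e$ for some $\mathbf e\in\mathbb NA$. For $I_A\ne\{0\}$, the minimal binomial $A$-degrees are the minimal elements, with respect to $\ge$, of the set of $A$-degrees of (nonzero) binomials in $I_A$.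 A binomial $B\in I_A$ is indispensable if every system of binomial generators of $I_A$ contains $B$ or $-B$. $\mathcal M_A$ is the monomial ideal generated by all $\mathbf x^{\mathbf u}$ for which there exists a nonzero binomial $\mathbf x^{\mathbf u}-\mathbf x^{\mathbf v}\in I_A$, and $T_A$ is its unique minimal monomial generating set. The indispensable complex $\Delta_{\mathrm{ind}(A)}$ is the simplicial complex with vertices the elements of $T_A$ and faces all subsets of $T_A$ consisting of monomials with the same $A$-degree. *)

theory Defs
  imports "HOL-Library.Poly_Mapping" "HOL-Analysis.Finite_Cartesian_Product"
begin

text \<open>
  The configuration is a family \<open>a :: 'm \<Rightarrow> int ^ 'n\<close> over a finite index type, so that \<open>m\<close> is the
  cardinality of \<open>'m\<close> and \<open>n\<close> that of \<open>'n\<close>. Exponent vectors are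
  elements of \<open>'m \<Rightarrow>\<^sub>0 nat\<close>, and the ring of polynomials over \<open>'k\<close> in variables indexed by \<open>'m\<close> is
  \<open>('m \<Rightarrow>\<^sub>0 nat) \<Rightarrow>\<^sub>0 'k\<close> with its convolution product. Multiplication makes a commutative ring a module
  over itself, whose submodules are the ideals; \<open>ideal.span G\<close> is the ideal generated by \<open>G\<close>.
\<close>

global_interpretation ideal: module "(*) :: 'r::comm_ring_1 \<Rightarrow> 'r \<Rightarrow> 'r"
  by standard (simp_all add: algebra_simps)

type_synonym ('m, 'k) mpoly = "('m \<Rightarrow>\<^sub>0 nat) \<Rightarrow>\<^sub>0 'k"

definition monomial :: "('m \<Rightarrow>\<^sub>0 nat) \<Rightarrow> ('m, 'k::comm_ring_1) mpoly" where
  "monomial u = Poly_Mapping.single u 1"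


subsection \<open>The affine semigroup and the grading\<close>

definition semigroup_of :: "('m::finite \<Rightarrow> int ^ 'n) \<Rightarrow> (int ^ 'n) set" where
  "semigroup_of a = {\<Sum>i\<in>UNIV. int (l i) *s a i | l :: 'm \<Rightarrow> nat. True}"

definition pointed :: "('m::finite \<Rightarrow> int ^ 'n) \<Rightarrow> bool" where
  "pointed a \<longleftrightarrow> (\<forall>c \<in> semigroup_of a. - c \<in> semigroup_of a \<longrightarrow> c = 0)"

definition A_deg :: "('m::finite \<Rightarrow> int ^ 'n) \<Rightarrow> ('m \<Rightarrow>\<^sub>0 nat) \<Rightarrow> int ^ 'n" where
  "A_deg a u = (\<Sum>i\<in>UNIV. int (Poly_Mapping.lookup u i) *s a i)"

definition semigroup_ge :: "('m::finite \<Rightarrow> int ^ 'n) \<Rightarrow> int ^ 'n \<Rightarrow> int ^ 'n \<Rightarrow> bool" where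
  "semigroup_ge a c d \<longleftrightarrow> (\<exists>e \<in> semigroup_of a. c = d + e)"


subsection \<open>Toric ideals and indispensable binomials\<close>

text \<open>Binomials are differences of two monomials with coefficient one; the zero polynomial is among them.\<close>

definition binomials :: "('m, 'k::comm_ring_1) mpoly set" where
  "binomials = {monomial u - monomial v | u v. True}"

definition toric_ideal :: "('m::finite \<Rightarrow> int ^ 'n) \<Rightarrow> ('m, 'k::field) mpoly set" where
  "toric_ideal a = ideal.span {monomial u - monomial v | u v. A_deg a u = A_deg a v}"

text \<open>
  The ideal \<open>I\<close>, meant to be \<open>toric_ideal a\<close>, is an explicit argument in the next definition because
  the type of the result does not mention the coefficient field.
\<close>

definition binomial_degrees ::
    "('m::finite \<Rightarrow> int ^ 'n) \<Rightarrow> ('m, 'k::field) mpoly set \<Rightarrow> (int ^ 'n) set" where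
  "binomial_degrees a I =
     {A_deg a u | u v. monomial u - monomial v \<in> I \<and> monomial u - monomial v \<noteq> (0 :: ('m, 'k) mpoly)}"

definition minimal_binomial_degrees ::
    "('m::finite \<Rightarrow> int ^ 'n) \<Rightarrow> ('m, 'k::field) mpoly set \<Rightarrow> (int ^ 'n) set" where
  "minimal_binomial_degrees a I =
     {b \<in> binomial_degrees a I. \<forall>c \<in> binomial_degrees a I. semigroup_ge a b c \<longrightarrow> c = b}"

definition indispensable :: "('m::finite \<Rightarrow> int ^ 'n) \<Rightarrow> ('m, 'k::field) mpoly \<Rightarrow> bool" where
  "indispensable a B \<longleftrightarrow> B \<in> binomials \<and> B \<in> toric_ideal a \<and>
     (\<forall>G \<subseteq> binomials. ideal.span G = toric_ideal a \<longrightarrow> B \<in> G \<or> - B \<in> G)"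


subsection \<open>The monomial ideal and its minimal monomial generators\<close>

definition M_ideal :: "('m::finite \<Rightarrow> int ^ 'n) \<Rightarrow> ('m, 'k::field) mpoly set" where
  "M_ideal a = ideal.span {monomial u | u. \<exists>v. monomial u - monomial v \<in> (toric_ideal a :: ('m, 'k) mpoly set)
                                      \<and> monomial u - monomial v \<noteq> (0 :: ('m, 'k) mpoly)}"

definition minimal_monomial_generating_set ::
    "('m, 'k::field) mpoly set \<Rightarrow> ('m, 'k) mpoly set \<Rightarrow> bool" where
  "minimal_monomial_generating_set I G \<longleftrightarrow>
     G \<subseteq> range monomial \<and> ideal.span G = I \<and> (\<forall>H. H \<subset> G \<longrightarrow> ideal.span H \<noteq> I)"

definition T_set :: "('m::finite \<Rightarrow> int ^ 'n) \<Rightarrow> ('m, 'k::field) mpoly set" where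
  "T_set a = (THE G. minimal_monomial_generating_set (M_ideal a) G)"


subsection \<open>The indispensable complex\<close>

text \<open>A simplicial complex is represented by the set of its faces, the empty face included.\<close>

definition indispensable_complex :: "('m::finite \<Rightarrow> int ^ 'n) \<Rightarrow> ('m, 'k::field) mpoly set set" where
  "indispensable_complex a =
     {F. F \<subseteq> T_set a \<and> (\<exists>b. \<forall>t \<in> F. \<exists>w. t = monomial w \<and> A_deg a w = b)}"

definition facet :: "'v set set \<Rightarrow> 'v set \<Rightarrow> bool" where
  "facet \<Delta> F \<longleftrightarrow> F \<in> \<Delta> \<and> (\<forall>G \<in> \<Delta>. F \<subseteq> G \<longrightarrow> G = F)"

definition face_dim :: "'v set \<Rightarrow> int" where
  "face_dim F = int (card F) - 1"


subsection \<open>Existence and uniqueness of the minimal monomial generating set\<close>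

lemma monomial_inj: "inj (monomial :: _ \<Rightarrow> ('m, 'k::comm_ring_1) mpoly)"
proof (rule injI)
  fix u v :: "'m \<Rightarrow>\<^sub>0 nat"
  assume "monomial u = (monomial v :: ('m, 'k) mpoly)"
  then have "Poly_Mapping.keys (monomial u :: ('m, 'k) mpoly) = Poly_Mapping.keys (monomial v :: ('m, 'k) mpoly)" by simp
  then show "u = v" by (simp add: monomial_def)
qed

lemma monomial_in_span_iff:
  "monomial w \<in> ideal.span (monomial ` S :: ('m, 'k::comm_ring_1) mpoly set)
     \<longleftrightarrow> (\<exists>u \<in> S. \<exists>e. w = u + e)"
proof
  let ?P = "{p :: ('m, 'k) mpoly. \<forall>w \<in> Poly_Mapping.keys p. \<exists>u \<in> S. \<exists>e. w = u + e}"
  have "ideal.subspace ?P"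
  proof (rule ideal.subspaceI)
    show "x + y \<in> ?P" if "x \<in> ?P" "y \<in> ?P" for x y
      using that Poly_Mapping.keys_add[of x y] by blast
    show "c * x \<in> ?P" if x: "x \<in> ?P" for c x
    proof safe
      fix w assume "w \<in> Poly_Mapping.keys (c * x)"
      then obtain k l where "w = k + l" "l \<in> Poly_Mapping.keys x"
        using keys_mult[of c x] by blast
      moreover from this x obtain u e where "u \<in> S" "l = u + e" by blast
      ultimately have "w = u + (k + e)" by (simp add: ac_simps)
      with \<open>u \<in> S\<close> show "\<exists>u \<in> S. \<exists>e. w = u + e" by blast
    qed
  qed simp
  moreover have "monomial ` S \<subseteq> ?P"
    by (simp add: monomial_def image_subset_iff) (metis add_0_right)
  ultimately have "ideal.span (monomial ` S) \<subseteq> ?P" by (rule ideal.span_minimal[rotated])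
  moreover assume "monomial w \<in> ideal.span (monomial ` S :: ('m, 'k) mpoly set)"
  ultimately have "(monomial w :: ('m, 'k) mpoly) \<in> ?P" by blast
  then show "\<exists>u \<in> S. \<exists>e. w = u + e"
    by (simp add: monomial_def)
next
  assume "\<exists>u \<in> S. \<exists>e. w = u + e"
  then obtain u e where u: "u \<in> S" and w: "w = u + e" by blast
  have "monomial w = (monomial e * monomial u :: ('m, 'k) mpoly)"
    by (simp add: monomial_def mult_single w add.commute)
  then show "monomial w \<in> ideal.span (monomial ` S :: ('m, 'k) mpoly set)"
    using u by (metis ideal.span_base ideal.span_scale imageI)
qed

lemma ex1_minimal_monomial_generating_set:
  fixes S :: "('m::finite \<Rightarrow>\<^sub>0 nat) set"
  shows "\<exists>!G. minimal_monomial_generating_set (ideal.span (monomial ` S :: ('m, 'k::field) mpoly set)) G"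
proof -
  let ?I = "ideal.span (monomial ` S :: ('m, 'k) mpoly set)"
  define N where "N = {u \<in> S. \<forall>u' \<in> S. \<forall>e. u = u' + e \<longrightarrow> u' = u}"
  have below: "\<exists>u' \<in> N. \<exists>e. u = u' + e" if "u \<in> S" for u
    using that
  proof (induction "\<Sum>i\<in>UNIV. Poly_Mapping.lookup u i" arbitrary: u rule: less_induct)
    case less
    show ?case
    proof (cases "u \<in> N")
      case True
      then show ?thesis by (metis add_0_right)
    next
      case False
      then obtain u' e where u': "u' \<in> S" "u = u' + e" "u' \<noteq> u"
        using less.prems by (auto simp: N_def)
      then have "e \<noteq> 0" by auto
      then obtain i where "Poly_Mapping.lookup e i \<noteq> 0" by (force intro: poly_mapping_eqI)
      then have "(\<Sum>i\<in>UNIV. Poly_Mapping.lookup e i) > 0" by (intro sum_pos2[of _ i]) auto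
      then have "(\<Sum>i\<in>UNIV. Poly_Mapping.lookup u' i) < (\<Sum>i\<in>UNIV. Poly_Mapping.lookup u i)"
        by (simp add: u'(2) lookup_add sum.distrib)
      from less.hyps[OF this u'(1)] show ?thesis
        by (metis u'(2) add.assoc)
    qed
  qed
  have gen: "ideal.span (monomial ` N) = ?I"
  proof
    show "ideal.span (monomial ` N) \<subseteq> ?I" by (rule ideal.span_mono) (auto simp: N_def)
    have "monomial ` S \<subseteq> ideal.span (monomial ` N :: ('m, 'k) mpoly set)"
      using below by (auto simp: monomial_in_span_iff)
    then show "?I \<subseteq> ideal.span (monomial ` N)"
      using ideal.span_minimal ideal.subspace_span by blast
  qed
  have least: "monomial ` N \<subseteq> H" if "H \<subseteq> range monomial" "ideal.span H = ?I" for H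
  proof -
    from that(1) obtain R where R: "H = monomial ` R" by (auto simp: subset_image_iff)
    have "u \<in> R" if u: "u \<in> N" for u
    proof -
      have "monomial u \<in> ideal.span (monomial ` R :: ('m, 'k) mpoly set)"
        using u \<open>ideal.span H = ?I\<close> R by (simp add: N_def ideal.span_base)
      then obtain r e where r: "r \<in> R" "u = r + e" by (auto simp: monomial_in_span_iff)
      have "monomial r \<in> ?I"
        using r \<open>ideal.span H = ?I\<close> R by (metis ideal.span_base imageI)
      then obtain s f where s: "s \<in> S" "r = s + f" by (auto simp: monomial_in_span_iff)
      then have "u = s + (f + e)" using r by (simp add: add.assoc)
      with s u have "s = u" unfolding N_def by blast
      then have "f + e = 0" using \<open>u = s + (f + e)\<close> by simp
      then have "Poly_Mapping.lookup f i + Poly_Mapping.lookup e i = 0" for i by (simp flip: lookup_add)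
      then have "e = 0" by (intro poly_mapping_eqI) simp
      with r show "u \<in> R" by simp
    qed
    then show ?thesis using R by blast
  qed
  show ?thesis
  proof (rule ex1I[of _ "monomial ` N"])
    show "minimal_monomial_generating_set ?I (monomial ` N)"
      unfolding minimal_monomial_generating_set_def using gen least by blast
    show "G = monomial ` N" if "minimal_monomial_generating_set ?I G" for G
      using that gen least[of G] unfolding minimal_monomial_generating_set_def by blast
  qed
qed

lemma T_set_minimal_monomial_generating_set:
  "minimal_monomial_generating_set (M_ideal a) (T_set a :: ('m::finite, 'k::field) mpoly set)"
  unfolding T_set_def M_ideal_def setcompr_eq_image
  by (rule theI') (rule ex1_minimal_monomial_generating_set)

end

theory Submission
  imports Defs
begin

text \<open>
  Both sides of the equivalence amount to the fiber of \<open>u\<close> being \<open>{u, v}\<close> with \<open>u\<close> and \<open>v\<close> minimal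
  among the exponents with a nontrivial fiber. If \<open>B\<close> is indispensable, it is not generated by
  binomials other than \<open>B\<close> and \<open>-B\<close>; a third point of the fiber, or a binomial properly below \<open>B\<close>,
  would give such a generation. Conversely, minimality of \<open>u\<close> implies that a binomial of the ideal
  has a multiple in which \<open>x\<^sup>u\<close> occurs only if \<open>x\<^sup>u\<close> is one of its two terms, and then the fiber
  forces it to be \<open>B\<close> or \<open>-B\<close>; hence every generating set contains one of these.
  Pointedness rules out nonzero exponents of degree zero.
\<close>

section \<open>Degrees, the semigroup and pointedness\<close>

lemma A_deg_add: "A_deg a (u + v) = A_deg a u + A_deg a v"
  by (simp add: A_deg_def lookup_add sum.distrib vector_sadd_rdistrib)

lemma A_deg_single: "A_deg a (Poly_Mapping.single i 1) = a i"
proof -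
  have "A_deg a (Poly_Mapping.single i 1) = (\<Sum>j\<in>UNIV. if i = j then a j else 0)"
    unfolding A_deg_def by (rule sum.cong) (auto simp: lookup_single when_def)
  then show ?thesis by simp
qed

lemma semigroup_of_eq_range: "semigroup_of a = range (A_deg a)"
proof -
  have "(\<Sum>i\<in>UNIV. int (l i) *s a i) \<in> range (A_deg a)" for l
    by (rule range_eqI[of _ _ "Abs_poly_mapping l"]) (simp add: A_deg_def)
  moreover have "A_deg a t \<in> semigroup_of a" for t
    by (auto simp: semigroup_of_def A_deg_def)
  ultimately show ?thesis
    unfolding semigroup_of_def by blast
qed

lemma semigroup_ge_iff: "semigroup_ge a c d \<longleftrightarrow> (\<exists>t. c = d + A_deg a t)"
  by (auto simp: semigroup_ge_def semigroup_of_eq_range)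

text \<open>Taking one unit of the i-th coordinate out of \<open>t\<close> exhibits
  \<open>- a i\<close> as the degree of the rest, so \<open>a i\<close> is invertible in the
  semigroup. Pointedness alone admits zero vectors in the configuration, hence the conclusion
  \<open>a i = 0\<close> instead of \<open>t = 0\<close>.\<close>

lemma pointed_A_deg_eq_0:
  assumes "pointed a" "A_deg a t = 0" "Poly_Mapping.lookup t i \<noteq> 0"
  shows "a i = 0"
proof -
  let ?s = "t - Poly_Mapping.single i 1"
  have "t = ?s + Poly_Mapping.single i 1"
    using assms(3) by (intro poly_mapping_eqI) (auto simp: lookup_add lookup_minus lookup_single when_def)
  then have "A_deg a ?s + a i = 0"
    using assms(2) by (metis A_deg_add A_deg_single)
  then have neg: "- a i = A_deg a ?s"
    by (simp only: eq_neg_iff_add_eq_0[symmetric])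
  have "a i \<in> semigroup_of a"
    unfolding semigroup_of_eq_range by (rule range_eqI) (rule A_deg_single[symmetric])
  moreover have "- a i \<in> semigroup_of a"
    unfolding semigroup_of_eq_range neg by (rule rangeI)
  ultimately show ?thesis
    using assms(1) unfolding pointed_def by blast
qed

section \<open>Binomials and their membership in the toric ideal\<close>

lemma exponent_add_eq_0: "e + f = 0 \<longleftrightarrow> e = 0 \<and> f = 0"
  for e f :: "'m \<Rightarrow>\<^sub>0 nat"
proof
  assume "e + f = 0"
  then have "Poly_Mapping.lookup e i + Poly_Mapping.lookup f i = 0" for i
    by (simp flip: lookup_add)
  then show "e = 0 \<and> f = 0" by (auto intro: poly_mapping_eqI)
qed simp

lemma monomial_mult_diff:
  "monomial t * (monomial p - monomial q) = (monomial (p + t) - monomial (q + t) :: ('m, 'k::comm_ring_1) mpoly)"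
  by (simp add: monomial_def right_diff_distrib mult_single add.commute)

lemma monomial_diff_eq_0_iff:
  "monomial u - monomial v = (0 :: ('m, 'k::comm_ring_1) mpoly) \<longleftrightarrow> u = v"
  using monomial_inj by (auto dest: injD)

lemma keys_monomial_diff:
  assumes "u \<noteq> v"
  shows "Poly_Mapping.keys (monomial u - monomial v :: ('m, 'k::comm_ring_1) mpoly) = {u, v}"
  using assms by (auto simp: monomial_def in_keys_iff lookup_minus lookup_single when_def split: if_splits)

text \<open>The two supports agree; the sign is lost, so only the unordered pair of exponents is
  recovered.\<close>

lemma monomial_diff_eq_pm_D:
  fixes u v p q :: "'m \<Rightarrow>\<^sub>0 nat"
  assumes "u \<noteq> v"
    and "monomial p - monomial q = (monomial u - monomial v :: ('m, 'k::comm_ring_1) mpoly) \<or>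
         monomial p - monomial q = - (monomial u - monomial v :: ('m, 'k) mpoly)"
  shows "{p, q} = {u, v}"
proof -
  have keys: "Poly_Mapping.keys (monomial p - monomial q :: ('m, 'k) mpoly) = {u, v}"
    using assms(2) unfolding minus_diff_eq
    by (elim disjE) (simp_all only: keys_monomial_diff[OF assms(1)]
        keys_monomial_diff[OF assms(1)[symmetric]] insert_commute)
  then have "p \<noteq> q" by (metis cancel_comm_monoid_add_class.diff_cancel insert_not_empty keys_zero)
  from keys_monomial_diff[OF this] keys show ?thesis by (rule trans[OF sym])
qed

text \<open>The coefficient sum over one degree vanishes on every multiple of a generator.\<close>

lemma monomial_diff_in_toric_ideal_iff:
  "monomial p - monomial q \<in> (toric_ideal a :: ('m::finite, 'k::field) mpoly set) \<longleftrightarrow> A_deg a p = A_deg a q"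
proof
  define L :: "('m, 'k) mpoly \<Rightarrow> 'k" where
    "L f = Sum_any (\<lambda>w. if A_deg a w = A_deg a p then Poly_Mapping.lookup f w else 0)" for f
  have fin: "finite {w. (if A_deg a w = A_deg a p then Poly_Mapping.lookup f w else 0) \<noteq> 0}"
    for f :: "('m, 'k) mpoly"
    by (rule finite_subset[OF _ finite_lookup[of f]]) auto
  have L_add: "L (f + g) = L f + L g" for f g
    unfolding L_def Sum_any.distrib[OF fin fin, symmetric]
    by (rule Sum_any.cong) (simp add: lookup_add)
  have L_single: "L (Poly_Mapping.single w c) = (if A_deg a w = A_deg a p then c else 0)" for w c
  proof -
    have "L (Poly_Mapping.single w c) = Sum_any (\<lambda>w'. (if A_deg a w = A_deg a p then c else 0) when w' = w)"
      unfolding L_def by (rule Sum_any.cong) (auto simp: lookup_single when_def)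
    then show ?thesis by simp
  qed
  have L_diff: "L (f - g) = L f - L g" for f g
    using L_add[of "f - g" g] by simp
  \<comment> \<open>Quantifying over all multipliers \<open>c\<close> turns the kernel of the
    additive map \<open>L\<close> into an ideal.\<close>
  let ?P = "{f. \<forall>c. L (c * f) = 0}"
  have "ideal.subspace ?P"
  proof (rule ideal.subspaceI)
    show "0 \<in> ?P" using L_diff[of 0 0] by simp
    show "x + y \<in> ?P" if "x \<in> ?P" "y \<in> ?P" for x y
      using that by (simp add: distrib_left L_add)
    show "c * x \<in> ?P" if "x \<in> ?P" for c x
      using that by (simp flip: mult.assoc)
  qed
  moreover have "L (c * (monomial u - monomial v)) = 0" if "A_deg a u = A_deg a v" for u v c
  \<comment> \<open>By additivity one term of \<open>c\<close> suffices. It shifts \<open>u\<close>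
    and \<open>v\<close> by the same exponent, so both land in the selected degree and cancel, or
    neither does.\<close>
  proof (induction c rule: update_induct)
    case const
    show ?case using L_diff[of 0 0] by simp
  next
    case (update f k x)
    have "Poly_Mapping.update k x f = Poly_Mapping.single k x + f"
      using update(1)
      by (intro poly_mapping_eqI) (auto simp: lookup_update lookup_add lookup_single in_keys_iff when_def)
    moreover have "L (Poly_Mapping.single k x * (monomial u - monomial v)) = 0"
      by (simp add: monomial_def right_diff_distrib mult_single L_diff L_single A_deg_add that)
    ultimately show ?case using update(3) by (simp add: distrib_right L_add)
  qed
  ultimately have "toric_ideal a \<subseteq> ?P"
    unfolding toric_ideal_def by (intro ideal.span_minimal) auto
  moreover assume "monomial p - monomial q \<in> (toric_ideal a :: ('m, 'k) mpoly set)"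
  ultimately have "L (1 * (monomial p - monomial q)) = 0" by blast
  then show "A_deg a p = A_deg a q"
    by (simp add: monomial_def L_diff L_single split: if_splits)
next
  assume "A_deg a p = A_deg a q"
  then show "monomial p - monomial q \<in> (toric_ideal a :: ('m, 'k) mpoly set)"
    unfolding toric_ideal_def by (intro ideal.span_base) blast
qed

section \<open>Nontrivial fibers and the minimal generators of \<open>M_ideal\<close>\<close>

text \<open>The exponents of monomials in nonzero binomials of the toric ideal, expressed without
  reference to the coefficient field.\<close>

definition nontrivial_fiber :: "('m::finite \<Rightarrow> int ^ 'n) \<Rightarrow> ('m \<Rightarrow>\<^sub>0 nat) set" where
  "nontrivial_fiber a = {u. \<exists>v. A_deg a u = A_deg a v \<and> u \<noteq> v}"

lemma nontrivial_fiberI: "A_deg a u = A_deg a v \<Longrightarrow> u \<noteq> v \<Longrightarrow> u \<in> nontrivial_fiber a"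
  by (auto simp: nontrivial_fiber_def)

lemma binomial_degrees_toric_ideal:
  "binomial_degrees a (toric_ideal a :: ('m::finite, 'k::field) mpoly set) = A_deg a ` nontrivial_fiber a"
  unfolding binomial_degrees_def nontrivial_fiber_def monomial_diff_in_toric_ideal_iff
    monomial_diff_eq_0_iff by auto

lemma M_ideal_eq: "M_ideal a = (ideal.span (monomial ` nontrivial_fiber a) :: ('m::finite, 'k::field) mpoly set)"
  unfolding M_ideal_def nontrivial_fiber_def monomial_diff_in_toric_ideal_iff
    monomial_diff_eq_0_iff image_Collect ..

text \<open>Turns the definite description of \<open>T_set\<close> into minimality under
  divisibility. Exponents of \<open>T_set\<close> and of nontrivial fibers generate the same
  monomial ideal, so each exponent of one kind is divisible by one of the other.\<close>

lemma monomial_in_T_set_iff: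
  "monomial u \<in> (T_set a :: ('m::finite, 'k::field) mpoly set) \<longleftrightarrow>
     u \<in> nontrivial_fiber a \<and> (\<forall>p\<in>nontrivial_fiber a. \<forall>e. u = p + e \<longrightarrow> e = 0)"
proof -
  let ?T = "T_set a :: ('m, 'k) mpoly set"
  let ?S = "nontrivial_fiber a"
  have T: "?T \<subseteq> range monomial" "ideal.span ?T = M_ideal a"
    "\<And>H. H \<subset> ?T \<Longrightarrow> ideal.span H \<noteq> M_ideal a"
    using T_set_minimal_monomial_generating_set[of a, where 'k='k]
    unfolding minimal_monomial_generating_set_def by blast+
  from T(1) obtain R where R: "?T = monomial ` R" by (auto simp: subset_image_iff)
  have S_R: "\<exists>r\<in>R. \<exists>e. p = r + e" if "p \<in> ?S" for p
  proof -
    have "monomial p \<in> ideal.span ?T"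
      using that by (simp add: T(2) M_ideal_eq ideal.span_base)
    then show ?thesis by (simp add: R monomial_in_span_iff)
  qed
  have R_S: "\<exists>p\<in>?S. \<exists>e. r = p + e" if "r \<in> R" for r
  proof -
    have "(monomial r :: ('m, 'k) mpoly) \<in> M_ideal a"
      using that R by (metis T(2) ideal.span_base imageI)
    then show ?thesis by (simp add: M_ideal_eq monomial_in_span_iff)
  qed
  have u_R: "monomial u \<in> ?T \<longleftrightarrow> u \<in> R"
    unfolding R using monomial_inj by (rule inj_image_mem_iff)
  show ?thesis
  proof
    assume "monomial u \<in> ?T"
    then have u: "u \<in> R" by (simp add: u_R)
    have min: "e = 0" if "p \<in> ?S" "u = p + e" for p e
    proof (rule ccontr)
      assume "e \<noteq> 0"
      \<comment> \<open>A proper divisor \<open>p\<close> of \<open>u\<close> has itself a divisor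
        \<open>r\<close> in \<open>R\<close>. Then \<open>u\<close> is redundant in
        \<open>R\<close>, against the minimality of the generating set.\<close>
      obtain r f where r: "r \<in> R" "p = r + f" using S_R \<open>p \<in> ?S\<close> by blast
      then have ur: "u = r + (f + e)" using that by (simp add: add.assoc)
      have "r \<noteq> u" using ur \<open>e \<noteq> 0\<close> by (auto simp: exponent_add_eq_0)
      have "monomial u \<in> ideal.span (monomial ` (R - {u}) :: ('m, 'k) mpoly set)"
        using r(1) \<open>r \<noteq> u\<close> ur by (auto simp: monomial_in_span_iff)
      then have "monomial ` R \<subseteq> ideal.span (monomial ` (R - {u}) :: ('m, 'k) mpoly set)"
        by (auto intro: ideal.span_base)
      then have "ideal.span (monomial ` (R - {u}) :: ('m, 'k) mpoly set) = M_ideal a"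
        unfolding T(2)[symmetric] R
        by (intro subset_antisym ideal.span_mono ideal.span_minimal ideal.subspace_span) auto
      moreover have "monomial ` (R - {u}) \<subset> ?T"
        unfolding R using u monomial_inj by (auto dest: injD)
      ultimately show False using T(3) by blast
    qed
    moreover have "u \<in> ?S" using R_S[OF u] min by force
    ultimately show "u \<in> ?S \<and> (\<forall>p\<in>?S. \<forall>e. u = p + e \<longrightarrow> e = 0)" by blast
  next
    assume u: "u \<in> ?S \<and> (\<forall>p\<in>?S. \<forall>e. u = p + e \<longrightarrow> e = 0)"
    obtain r e where r: "r \<in> R" "u = r + e" using S_R u by blast
    obtain p f where p: "p \<in> ?S" "r = p + f" using R_S r(1) by blast
    \<comment> \<open>Here \<open>u\<close> is a multiple of \<open>r\<close> and \<open>r\<close>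
      one of \<open>p\<close>; minimality of \<open>u\<close> collapses the chain, so
      \<open>u = r\<close>.\<close>
    have "f + e = 0" using u p r(2) by (metis add.assoc)
    then show "monomial u \<in> ?T" using r unfolding u_R by (simp add: exponent_add_eq_0)
  qed
qed

section \<open>Consequences of indispensability\<close>

text \<open>In the set of all binomials of the ideal, replace \<open>B\<close> and
  \<open>- B\<close> by \<open>H\<close>. As \<open>H\<close> generates \<open>B\<close>, the result
  still generates the toric ideal, and only \<open>H\<close> can contribute \<open>B\<close> or
  \<open>- B\<close> to it.\<close>

lemma indispensable_in_generators:
  fixes B :: "('m::finite, 'k::field) mpoly"
  assumes "indispensable a B" "H \<subseteq> binomials \<inter> toric_ideal a" "B \<in> ideal.span H"
  shows "B \<in> H \<or> - B \<in> H"
proof -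
  define G where "G = (binomials \<inter> toric_ideal a - {B, - B}) \<union> H"
  have B: "B \<in> ideal.span G"
    using assms(3) ideal.span_mono[of H G] unfolding G_def by blast
  have "toric_ideal a \<subseteq> ideal.span G"
    unfolding toric_ideal_def[of a]
  proof (rule ideal.span_minimal)
    show "{monomial u - monomial v |u v. A_deg a u = A_deg a v} \<subseteq> ideal.span G"
    proof safe
      fix u v assume "A_deg a u = A_deg a v"
      then have "monomial u - monomial v \<in> (binomials \<inter> toric_ideal a :: ('m, 'k) mpoly set)"
        by (auto simp: binomials_def monomial_diff_in_toric_ideal_iff)
      then show "monomial u - monomial v \<in> ideal.span G"
        using B ideal.span_neg[OF B] unfolding G_def by (metis DiffI UnI1 empty_iff ideal.span_base insert_iff)
    qed
  qed (rule ideal.subspace_span)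
  moreover have "ideal.span G \<subseteq> toric_ideal a"
  proof (rule ideal.span_minimal)
    show "G \<subseteq> toric_ideal a" using assms(2) by (auto simp: G_def)
  qed (simp add: toric_ideal_def)
  moreover have "G \<subseteq> binomials" using assms(2) by (auto simp: G_def)
  ultimately have "B \<in> G \<or> - B \<in> G"
    using assms(1) unfolding indispensable_def by blast
  then show ?thesis by (auto simp: G_def)
qed

text \<open>The zero binomial is generated by the empty set. A third exponent \<open>w\<close> in
  the fiber would split \<open>B\<close> into two binomials of the ideal, both different from
  \<open>B\<close> and \<open>- B\<close>.\<close>

lemma indispensable_fiber:
  assumes "indispensable a (monomial u - monomial v :: ('m::finite, 'k::field) mpoly)"
    and "A_deg a w = A_deg a u"
  shows "u \<noteq> v" "w = u \<or> w = v"
proof -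
  let ?B = "monomial u - monomial v :: ('m, 'k) mpoly"
  have deg: "A_deg a u = A_deg a v"
    using assms(1) by (simp add: indispensable_def monomial_diff_in_toric_ideal_iff)
  show "u \<noteq> v"
    using indispensable_in_generators[OF assms(1), of "{}"] by (auto simp: ideal.span_zero)
  show "w = u \<or> w = v"
  proof (rule ccontr)
    assume w: "\<not> (w = u \<or> w = v)"
    let ?H = "{monomial u - monomial w, monomial w - monomial v} :: ('m, 'k) mpoly set"
    have "(monomial u - monomial w) + (monomial w - monomial v) \<in> ideal.span ?H"
      by (intro ideal.span_add ideal.span_base) auto
    then have "?B \<in> ideal.span ?H" by simp
    moreover have "?H \<subseteq> binomials \<inter> toric_ideal a"
      using assms(2) deg by (auto simp: binomials_def monomial_diff_in_toric_ideal_iff)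
    ultimately have "?B \<in> ?H \<or> - ?B \<in> ?H"
      using indispensable_in_generators[OF assms(1)] by blast
    then have "{u, w} = {u, v} \<or> {w, v} = {u, v}"
      using monomial_diff_eq_pm_D[OF \<open>u \<noteq> v\<close>, of u w, where 'k='k]
        monomial_diff_eq_pm_D[OF \<open>u \<noteq> v\<close>, of w v, where 'k='k] by auto
    then show False using w by auto
  qed
qed

text \<open>Multiplying a binomial at \<open>p\<close> by the monomial of \<open>t\<close> gives a
  binomial in the degree of \<open>u\<close>, which must be \<open>B\<close> up to sign because the
  fiber is \<open>{u, v}\<close>. Since the hypothesis is on degrees, this serves both for
  minimality of the degree and for minimality of \<open>u\<close> and \<open>v\<close> under
  divisibility.\<close>

lemma indispensable_minimal:
  assumes ind: "indispensable a (monomial u - monomial v :: ('m::finite, 'k::field) mpoly)"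
    and p: "p \<in> nontrivial_fiber a"
    and deg: "A_deg a u = A_deg a p + A_deg a t"
  shows "t = 0"
proof -
  let ?B = "monomial u - monomial v :: ('m, 'k) mpoly"
  obtain q where q: "A_deg a p = A_deg a q" "p \<noteq> q"
    using p by (auto simp: nontrivial_fiber_def)
  have "A_deg a (p + t) = A_deg a u" "A_deg a (q + t) = A_deg a u"
    using deg q by (auto simp: A_deg_add)
  note fiber = indispensable_fiber[OF ind this(1)] indispensable_fiber(2)[OF ind this(2)]
  moreover have "p + t \<noteq> q + t" using q(2) by simp
  ultimately have eq: "(u = p + t \<and> v = q + t) \<or> (u = q + t \<and> v = p + t)" by metis
  define C :: "('m, 'k) mpoly" where "C = monomial p - monomial q"
  have "monomial t * C \<in> ideal.span {C}"
    by (intro ideal.span_scale ideal.span_base) simp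
  moreover from this have "- (monomial t * C) \<in> ideal.span {C}"
    by (rule ideal.span_neg)
  moreover have "?B = monomial t * C \<or> ?B = - (monomial t * C)"
    unfolding C_def monomial_mult_diff minus_diff_eq using eq by blast
  ultimately have "?B \<in> ideal.span {C}" by metis
  moreover have "{C} \<subseteq> binomials \<inter> toric_ideal a"
    using q(1) by (auto simp: C_def binomials_def monomial_diff_in_toric_ideal_iff)
  ultimately have "C = ?B \<or> C = - ?B"
    using indispensable_in_generators[OF ind] by blast
  then have pq: "{p, q} = {u, v}"
    unfolding C_def by (rule monomial_diff_eq_pm_D[OF fiber(1)])
  \<comment> \<open>The pair \<open>(p, q)\<close> is \<open>(u, v)\<close> or
    \<open>(v, u)\<close>. If the shift by \<open>t\<close> exchanges \<open>u\<close> and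
    \<open>v\<close>, applying it twice returns to \<open>u\<close>.\<close>
  have "u = u + t \<or> u = u + (t + t)"
    using eq pq unfolding doubleton_eq_iff by (metis add.assoc)
  then have "t = 0 \<or> t + t = 0" by (metis add_cancel_right_right)
  then show ?thesis by (simp add: exponent_add_eq_0)
qed

section \<open>A sufficient condition for indispensability\<close>

lemma indispensable_if_minimal_fiber:
  assumes deg: "A_deg a u = A_deg a v" and "u \<noteq> v"
    and fiber: "\<And>w. A_deg a w = A_deg a u \<Longrightarrow> w = u \<or> w = v"
    and minimal: "\<And>p e. p \<in> nontrivial_fiber a \<Longrightarrow> u = p + e \<Longrightarrow> e = 0"
  shows "indispensable a (monomial u - monomial v :: ('m::finite, 'k::field) mpoly)"
  unfolding indispensable_def
proof (intro conjI allI impI)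
  let ?B = "monomial u - monomial v :: ('m, 'k) mpoly"
  show "?B \<in> binomials" by (auto simp: binomials_def)
  show B: "?B \<in> toric_ideal a" by (simp add: monomial_diff_in_toric_ideal_iff deg)
  fix G :: "('m, 'k) mpoly set"
  assume G: "G \<subseteq> binomials" "ideal.span G = toric_ideal a"
  show "?B \<in> G \<or> - ?B \<in> G"
  proof (rule ccontr)
    assume nB: "\<not> (?B \<in> G \<or> - ?B \<in> G)"
    \<comment> \<open>The polynomials none of whose multiples contains the monomial of
      \<open>u\<close> form an ideal. It will contain \<open>G\<close>, but it does not contain
      \<open>B\<close>.\<close>
    let ?P = "{f :: ('m, 'k) mpoly. \<forall>c. Poly_Mapping.lookup (c * f) u = 0}"
    have "ideal.subspace ?P"
    proof (rule ideal.subspaceI)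
      show "x + y \<in> ?P" if "x \<in> ?P" "y \<in> ?P" for x y
        using that by (simp add: distrib_left lookup_add)
      show "c * x \<in> ?P" if "x \<in> ?P" for c x
        using that by (simp flip: mult.assoc)
    qed simp
    moreover have "G \<subseteq> ?P"
    proof (intro subsetI CollectI allI)
      fix g c assume "g \<in> G"
      then obtain p q where g: "g = monomial p - monomial q" using G(1) by (auto simp: binomials_def)
      have "g \<in> toric_ideal a" using \<open>g \<in> G\<close> G(2) ideal.span_base by blast
      then have pq: "A_deg a p = A_deg a q" by (simp add: g monomial_diff_in_toric_ideal_iff)
      show "Poly_Mapping.lookup (c * g) u = 0"
      proof (rule ccontr)
        assume "Poly_Mapping.lookup (c * g) u \<noteq> 0"
        then have "u \<in> Poly_Mapping.keys (c * g)" by (simp add: in_keys_iff)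
        then obtain k l where kl: "u = k + l" "l \<in> Poly_Mapping.keys g"
          using keys_mult[of c g] by blast
        have "p \<noteq> q" using kl(2) by (auto simp: g)
        then have l: "l = p \<or> l = q" using kl(2) by (simp add: g keys_monomial_diff)
        then have "l \<in> nontrivial_fiber a" using pq \<open>p \<noteq> q\<close> by (metis nontrivial_fiberI)
        then have "u = l" using minimal[of l k] kl(1) by (simp add: add.commute)
        then have "(p = u \<and> q = v) \<or> (p = v \<and> q = u)"
          using l fiber[of p] fiber[of q] pq \<open>p \<noteq> q\<close> by auto
        then show False using nB \<open>g \<in> G\<close> by (auto simp: g)
      qed
    qed
    ultimately have "toric_ideal a \<subseteq> ?P"
      unfolding G(2)[symmetric] by (rule ideal.span_minimal[rotated])
    then have "Poly_Mapping.lookup (1 * ?B) u = 0" using B by blast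
    then show False
      using \<open>u \<noteq> v\<close> by (simp add: monomial_def lookup_minus lookup_single)
  qed
qed

section \<open>Translation to facets and minimal degrees\<close>

theorem theorem4p4:
  fixes a :: "'m::finite \<Rightarrow> int ^ 'n"
    and u v :: "'m \<Rightarrow>\<^sub>0 nat"
    and B :: "('m, 'k::field) mpoly"
  assumes "pointed a"
    and "B = monomial u - monomial v"
    and "B \<in> toric_ideal a"
  shows "indispensable a B \<longleftrightarrow>
    facet (indispensable_complex a) {monomial u :: ('m, 'k) mpoly, monomial v} \<and>
    face_dim {monomial u :: ('m, 'k) mpoly, monomial v} = 1 \<and>
    A_deg a u \<in> minimal_binomial_degrees a (toric_ideal a :: ('m, 'k) mpoly set)"
proof -
  let ?F = "{monomial u :: ('m, 'k) mpoly, monomial v}"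
  let ?T = "T_set a :: ('m, 'k) mpoly set"
  let ?S = "nontrivial_fiber a"
  have deg: "A_deg a u = A_deg a v"
    using assms(2,3) by (simp add: monomial_diff_in_toric_ideal_iff)
  have mono_eq: "monomial w = (monomial w' :: ('m, 'k) mpoly) \<longleftrightarrow> w = w'" for w w'
    using monomial_inj by (auto dest: injD)
  \<comment> \<open>The two-element notation collapses to a vertex when
    \<open>u = v\<close>.\<close>
  have dim: "face_dim ?F = 1 \<longleftrightarrow> u \<noteq> v"
    by (auto simp: face_dim_def mono_eq)
  \<comment> \<open>Equality of comparable degrees becomes vanishing of the degree of the difference
    \<open>t\<close>; passing on to \<open>t = 0\<close> is the task of \<open>deg_0\<close>
    below.\<close>
  have minimal_iff: "A_deg a u \<in> minimal_binomial_degrees a (toric_ideal a :: ('m, 'k) mpoly set) \<longleftrightarrow>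
      u \<in> ?S \<and> (\<forall>p\<in>?S. \<forall>t. A_deg a u = A_deg a p + A_deg a t \<longrightarrow> A_deg a t = 0)" if "u \<noteq> v"
  proof -
    have "u \<in> ?S" using deg that by (rule nontrivial_fiberI)
    then show ?thesis
      unfolding minimal_binomial_degrees_def binomial_degrees_toric_ideal
      by (auto simp: semigroup_ge_iff)
  qed
  show ?thesis
  proof (intro iffI conjI)
    assume "indispensable a B"
    then have ind: "indispensable a (monomial u - monomial v :: ('m, 'k) mpoly)" by (simp add: assms(2))
    note fiber = indispensable_fiber[OF ind]
    note minimal = indispensable_minimal[OF ind]
    have "u \<noteq> v" using fiber(1) by blast
    have S: "u \<in> ?S" "v \<in> ?S" using deg \<open>u \<noteq> v\<close> by (metis nontrivial_fiberI)+
    have T: "?F \<subseteq> ?T"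
      using S minimal deg by (auto simp: monomial_in_T_set_iff A_deg_add)
    show "facet (indispensable_complex a) ?F"
      unfolding facet_def
    proof (intro conjI ballI impI)
      show "?F \<in> indispensable_complex a"
        using T deg by (auto simp: indispensable_complex_def)
      fix G :: "('m, 'k) mpoly set"
      assume "G \<in> indispensable_complex a" and F: "?F \<subseteq> G"
      then obtain b where b: "\<forall>t \<in> G. \<exists>w. t = monomial w \<and> A_deg a w = b"
        by (auto simp: indispensable_complex_def)
      then have "b = A_deg a u" using F by (force simp: mono_eq)
      then have "G \<subseteq> ?F" using b fiber(2) by blast
      then show "G = ?F" using F by blast
    qed
    show "face_dim ?F = 1" using \<open>u \<noteq> v\<close> by (simp add: dim)
    show "A_deg a u \<in> minimal_binomial_degrees a (toric_ideal a :: ('m, 'k) mpoly set)"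
      unfolding minimal_iff[OF \<open>u \<noteq> v\<close>]
    proof (intro conjI ballI allI impI)
      show "A_deg a t = 0" if "p \<in> ?S" "A_deg a u = A_deg a p + A_deg a t" for p t
        using minimal[OF that] by (simp add: A_deg_def)
    qed (rule S)
  next
    assume asm: "facet (indispensable_complex a) ?F \<and> face_dim ?F = 1 \<and>
      A_deg a u \<in> minimal_binomial_degrees a (toric_ideal a :: ('m, 'k) mpoly set)"
    then have "u \<noteq> v" by (simp add: dim)
    have F: "?F \<subseteq> ?T" using asm by (auto simp: facet_def indispensable_complex_def)
    \<comment> \<open>If \<open>a i = 0\<close>, the exponents 0 and
      \<open>Poly_Mapping.single i 1\<close> share a degree, so 0 has a nontrivial fiber. It divides
      everything, leaving 0 as the only exponent in \<open>T_set\<close> and forcing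
      \<open>u = v\<close>.\<close>
    have a_nz: "a i \<noteq> 0" for i
    proof
      assume "a i = 0"
      have "A_deg a 0 = 0" by (simp add: A_deg_def)
      moreover have "Poly_Mapping.single i (1::nat) \<noteq> 0" by (metis lookup_single_eq lookup_zero one_neq_zero)
      ultimately have "0 \<in> ?S"
        using \<open>a i = 0\<close> A_deg_single[of a i] by (metis nontrivial_fiberI)
      then have "u = 0" "v = 0" using F by (auto simp: monomial_in_T_set_iff)
      then show False using \<open>u \<noteq> v\<close> by simp
    qed
    have deg_0: "t = 0" if "A_deg a t = 0" for t
      using pointed_A_deg_eq_0[OF assms(1) that] a_nz by (metis poly_mapping_eqI lookup_zero)
    have "A_deg a u \<in> minimal_binomial_degrees a (toric_ideal a :: ('m, 'k) mpoly set)"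
      using asm by blast
    note min_deg = this[unfolded minimal_iff[OF \<open>u \<noteq> v\<close>]]
    have minimal: "t = 0" if "p \<in> ?S" "A_deg a u = A_deg a p + A_deg a t" for p t
      by (rule deg_0) (rule min_deg[THEN conjunct2, rule_format, OF that])
    \<comment> \<open>Any \<open>w\<close> in the fiber inherits the minimal degree, so its monomial
      is a vertex of the complex. Adding it to the facet gives a face again, hence nothing
      new.\<close>
    have fiber: "w = u \<or> w = v" if w: "A_deg a w = A_deg a u" for w
    proof -
      have "w \<in> ?S" using w deg \<open>u \<noteq> v\<close> by (metis nontrivial_fiberI)
      then have "monomial w \<in> ?T"
        using minimal w by (auto simp: monomial_in_T_set_iff A_deg_add)
      then have "insert (monomial w) ?F \<in> indispensable_complex a"
        using F w deg by (auto simp: indispensable_complex_def)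
      then have "insert (monomial w) ?F = ?F" using asm unfolding facet_def by blast
      then have "monomial w \<in> ?F" by blast
      then show ?thesis by (simp add: mono_eq)
    qed
    show "indispensable a B"
      unfolding assms(2)
      using deg \<open>u \<noteq> v\<close> fiber
    proof (rule indispensable_if_minimal_fiber)
      show "e = 0" if "p \<in> ?S" "u = p + e" for p e
        using minimal[of p e] that by (simp add: A_deg_add)
    qed
  qed
qed

end
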